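(* Let $G$ be a finite group and let $Q_n(G)$ denote the Dowling lattice. (i) If $n=0$ or $n=1$, then $Q_n(G)$ is isomorphic to the lattice induced by a covering, i.e. there are a finite set $U$ and a covering $\mathcal{C}$ of $U$ with $L(\mathcal{C})\cong Q_n(G)$. (ii) Let $\mathcal{C}$ be a covering of a finite set $U$ with $|U|=m$, such that there are no two distinct elements $u,v\in U$ with $\mathcal{C}(\{u\})=\mathcal{C}(\{v\})$ and $|\mathcal{C}(\{u\})|=1$. Suppose that $L(\mathcal{C})$ is uniform and $|L^{(2)}(\mathcal{C})|<\binom{m}{2}$, and let $k:=|\mathcal{E}|$. If $n=2$, $m=|G|+2$, and $k=1$, then $L(\mathcal{C})\cong Q_2(G)$.
   Context: A covering of a finite set $U$ (possibly empty) is a collection $\mathcal{C}\subseteq 2^U$ of subsets of $U$ whose union is $U$. For $H\subseteq U$, $\mathcal{C}(H):=\{C\in\mathcal{C} : C\cap H\neq\emptyset\}$. The matroid $M(\mathcal{C})$ is the transversal matroid of $\mathcal{C}$ on the ground set $U$: its independent sets are the partial transversals of $\mathcal{C}$, i.e. the sets $I\subseteq U$ for which there is an injective map $\varphi:I\to\mathcal{C}$ with $e\in\varphi(e)$ for all $e\in I$. $L(\mathcal{C})$ is the lattice of closed sets (flats) of $M(\mathcal{C})$ ordered by inclusion, and $L^{(\ell)}(\mathcal{C})$ is the set of its elements of height $\ell$. A ranked lattice is uniform if any two elements of equal rank are covered by the same number of elements. For $x\in U$ with $|\mathcal{C}(\{x\})|=2$, $E(\{x\}):=\{y\in U : \mathcal{C}(\{y\})\subseteq\mathcal{C}(\{x\})\}$,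 and $\mathcal{E}:=\{E(\{x\}) : x\in U,\ |\mathcal{C}(\{x\})|=2\}$. Dowling lattice $Q_n(G)$: let $N=\{1,\dots,n\}$. A partial $G$-partition of $N$ is data $(Z;(B_1,a_1),\dots,(B_t,a_t))$ where $Z\subseteq N$ (the zero block), $\{B_1,\dots,B_t\}$ is a partition of $N\setminus Z$ into nonempty blocks, and each $a_i:B_i\to G$ is a function. Two such data are identified if they have the same zero block and the same nonzero blocks, and on each nonzero block $B$ the two labelings $a,a'$ satisfy $a'(x)=g\,a(x)$ for all $x\in B$, for some $g\in G$ (depending on $B$). The elements of $Q_n(G)$ are the resulting equivalence classes. The order is: $[(Z;(B_1,a_1),\dots,(B_t,a_t))]\leq[(Z';(C_1,b_1),\dots,(C_r,b_r))]$ if $Z\subseteq Z'$, each $C_j$ is a union of blocks among $B_1,\dots,B_t$, and for every $B_i\subseteq C_j$ there is $g_i\in G$ with $b_j(x)=g_i\,a_i(x)$ for all $x\in B_i$. *)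

theory Defs
  imports "HOL-Algebra.Coset" "HOL-Algebra.Lattice" "HOL-Library.Disjoint_Sets"
begin

section \<open>Finite ordered structures\<close>

text \<open>
  An isomorphism of lattices is the same as an isomorphism of the underlying ordered sets.
\<close>

definition order_isomorphic :: "('a, 'c) gorder_scheme \<Rightarrow> ('b, 'd) gorder_scheme \<Rightarrow> bool" where
  "order_isomorphic L M \<longleftrightarrow>
     (\<exists>f. bij_betw f (carrier L) (carrier M) \<and>
          (\<forall>x\<in>carrier L. \<forall>y\<in>carrier L. x \<sqsubseteq>\<^bsub>L\<^esub> y \<longleftrightarrow> f x \<sqsubseteq>\<^bsub>M\<^esub> f y))"

definition covered_by :: "('a, 'c) gorder_scheme \<Rightarrow> 'a \<Rightarrow> 'a \<Rightarrow> bool" where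
  "covered_by L x y \<longleftrightarrow>
     x \<sqsubset>\<^bsub>L\<^esub> y \<and> \<not> (\<exists>z\<in>carrier L. x \<sqsubset>\<^bsub>L\<^esub> z \<and> z \<sqsubset>\<^bsub>L\<^esub> y)"

definition is_chain :: "('a, 'c) gorder_scheme \<Rightarrow> 'a set \<Rightarrow> bool" where
  "is_chain L K \<longleftrightarrow>
     K \<subseteq> carrier L \<and> (\<forall>x\<in>K. \<forall>y\<in>K. x \<sqsubseteq>\<^bsub>L\<^esub> y \<or> y \<sqsubseteq>\<^bsub>L\<^esub> x)"

text \<open>
  The height of \<open>x\<close> is the maximal \<open>h\<close> for which there is a chain
  \<open>x\<^sub>0 < x\<^sub>1 < \<dots> < x\<^sub>h = x\<close>, that is, the maximal number of elements of a chain lying strictly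
  below \<open>x\<close>. It is meant for a finite \<open>carrier L\<close>; in a ranked lattice it is the rank.
\<close>

definition height :: "('a, 'c) gorder_scheme \<Rightarrow> 'a \<Rightarrow> nat" where
  "height L x = Max {card K | K. is_chain L K \<and> (\<forall>y\<in>K. y \<sqsubset>\<^bsub>L\<^esub> x)}"

definition level :: "('a, 'c) gorder_scheme \<Rightarrow> nat \<Rightarrow> 'a set" where
  "level L l = {x \<in> carrier L. height L x = l}"

definition uniform :: "('a, 'c) gorder_scheme \<Rightarrow> bool" where
  "uniform L \<longleftrightarrow>
     (\<forall>x\<in>carrier L. \<forall>y\<in>carrier L. height L x = height L y \<longrightarrow>
        card {z \<in> carrier L. covered_by L x z} = card {z \<in> carrier L. covered_by L y z})"


section \<open>The lattice induced by a covering\<close>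

definition covering :: "'a set \<Rightarrow> 'a set set \<Rightarrow> bool" where
  "covering U \<C> \<longleftrightarrow> \<C> \<subseteq> Pow U \<and> \<Union>\<C> = U"

definition meeting :: "'a set set \<Rightarrow> 'a set \<Rightarrow> 'a set set" where
  "meeting \<C> H = {C \<in> \<C>. C \<inter> H \<noteq> {}}"

definition partial_transversal :: "'a set \<Rightarrow> 'a set set \<Rightarrow> 'a set \<Rightarrow> bool" where
  "partial_transversal U \<C> I \<longleftrightarrow>
     I \<subseteq> U \<and> (\<exists>\<phi>. inj_on \<phi> I \<and> (\<forall>e\<in>I. \<phi> e \<in> \<C> \<and> e \<in> \<phi> e))"

text \<open>
  Rank, closure and flats of the matroid on the finite ground set \<open>U\<close> whose independent sets
  are the sets satisfying \<open>indep\<close>.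
\<close>

definition matroid_rank :: "('a set \<Rightarrow> bool) \<Rightarrow> 'a set \<Rightarrow> nat" where
  "matroid_rank indep X = Max {card I | I. I \<subseteq> X \<and> indep I}"

definition matroid_closure :: "'a set \<Rightarrow> ('a set \<Rightarrow> bool) \<Rightarrow> 'a set \<Rightarrow> 'a set" where
  "matroid_closure U indep X = {e \<in> U. matroid_rank indep (insert e X) = matroid_rank indep X}"

definition flats :: "'a set \<Rightarrow> ('a set \<Rightarrow> bool) \<Rightarrow> 'a set set" where
  "flats U indep = {F. F \<subseteq> U \<and> matroid_closure U indep F = F}"

definition covering_lattice :: "'a set \<Rightarrow> 'a set set \<Rightarrow> 'a set gorder" where
  "covering_lattice U \<C> =
     \<lparr>carrier = flats U (partial_transversal U \<C>), eq = (=), le = (\<subseteq>)\<rparr>"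

definition E_set :: "'a set \<Rightarrow> 'a set set \<Rightarrow> 'a \<Rightarrow> 'a set" where
  "E_set U \<C> x = {y \<in> U. meeting \<C> {y} \<subseteq> meeting \<C> {x}}"

definition E_family :: "'a set \<Rightarrow> 'a set set \<Rightarrow> 'a set set" where
  "E_family U \<C> = {E_set U \<C> x | x. x \<in> U \<and> card (meeting \<C> {x}) = 2}"


section \<open>Dowling lattices\<close>

text \<open>
  A partial \<open>G\<close>-partition of \<open>N = {1..n}\<close> is a triple \<open>(Z, P, a)\<close> with zero block \<open>Z\<close>, set of
  nonzero blocks \<open>P\<close>, and for every \<open>B \<in> P\<close> a labeling \<open>a B : B \<rightarrow> G\<close>. Extensional functions
  are used so that labelings carry no information outside their domain.
\<close>

type_synonym 'g gpartition = "nat set \<times> nat set set \<times> (nat set \<Rightarrow> nat \<Rightarrow> 'g)"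

definition gpartitions :: "nat \<Rightarrow> ('g, 'b) monoid_scheme \<Rightarrow> 'g gpartition set" where
  "gpartitions n G =
     {(Z, P, a). Z \<subseteq> {1..n} \<and> partition_on ({1..n} - Z) P \<and>
        a \<in> (\<Pi>\<^sub>E B\<in>P. B \<rightarrow>\<^sub>E carrier G)}"

definition gpartition_rel ::
    "nat \<Rightarrow> ('g, 'b) monoid_scheme \<Rightarrow> ('g gpartition \<times> 'g gpartition) set" where
  "gpartition_rel n G =
     {((Z, P, a), (Z', P', a')).
        (Z, P, a) \<in> gpartitions n G \<and> (Z', P', a') \<in> gpartitions n G \<and> Z = Z' \<and> P = P' \<and>
        (\<forall>B\<in>P. \<exists>g\<in>carrier G. \<forall>x\<in>B. a' B x = g \<otimes>\<^bsub>G\<^esub> a B x)}"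

definition gpartition_le ::
    "('g, 'b) monoid_scheme \<Rightarrow> 'g gpartition \<Rightarrow> 'g gpartition \<Rightarrow> bool" where
  "gpartition_le G = (\<lambda>(Z, P, a) (Z', Q, b).
     Z \<subseteq> Z' \<and>
     (\<forall>C\<in>Q. \<exists>S\<subseteq>P. C = \<Union>S) \<and>
     (\<forall>C\<in>Q. \<forall>B\<in>P. B \<subseteq> C \<longrightarrow> (\<exists>g\<in>carrier G. \<forall>x\<in>B. b C x = g \<otimes>\<^bsub>G\<^esub> a B x)))"

definition dowling_lattice :: "nat \<Rightarrow> ('g, 'b) monoid_scheme \<Rightarrow> 'g gpartition set gorder" where
  "dowling_lattice n G =
     \<lparr>carrier = gpartitions n G // gpartition_rel n G, eq = (=),
      le = (\<lambda>X Y. \<exists>p\<in>X. \<exists>q\<in>Y. gpartition_le G p q)\<rparr>"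

text \<open>The order on classes does not depend on the choice of representatives.\<close>

lemma gpartition_labelD:
  assumes "(Z, P, a) \<in> gpartitions n G" "B \<in> P" "x \<in> B"
  shows "a B x \<in> carrier G"
  using assms unfolding gpartitions_def by (auto dest!: PiE_mem)

lemma equiv_gpartition_rel:
  assumes "group G"
  shows "equiv (gpartitions n G) (gpartition_rel n G)"
proof -
  interpret group G by fact
  have rfl: "(p, p) \<in> gpartition_rel n G" if "p \<in> gpartitions n G" for p
  proof (cases p)
    case (fields Z P a)
    have "\<forall>B\<in>P. \<exists>g\<in>carrier G. \<forall>x\<in>B. a B x = g \<otimes>\<^bsub>G\<^esub> a B x"
    proof
      fix B assume "B \<in> P"
      then have "\<forall>x\<in>B. a B x = \<one>\<^bsub>G\<^esub> \<otimes>\<^bsub>G\<^esub> a B x"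
        using gpartition_labelD[OF that[unfolded fields]] by simp
      then show "\<exists>g\<in>carrier G. \<forall>x\<in>B. a B x = g \<otimes>\<^bsub>G\<^esub> a B x"
        using one_closed by blast
    qed
    then show ?thesis using that unfolding fields gpartition_rel_def by simp
  qed
  have sm: "(q, p) \<in> gpartition_rel n G" if pq: "(p, q) \<in> gpartition_rel n G" for p q
  proof -
    obtain Z P a a' where p: "p = (Z, P, a)" "q = (Z, P, a')"
      and mem: "(Z, P, a) \<in> gpartitions n G" "(Z, P, a') \<in> gpartitions n G"
      and eq: "\<forall>B\<in>P. \<exists>g\<in>carrier G. \<forall>x\<in>B. a' B x = g \<otimes>\<^bsub>G\<^esub> a B x"
      using pq unfolding gpartition_rel_def by auto
    have "\<forall>B\<in>P. \<exists>g\<in>carrier G. \<forall>x\<in>B. a B x = g \<otimes>\<^bsub>G\<^esub> a' B x"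
    proof
      fix B assume B: "B \<in> P"
      then obtain g where g: "g \<in> carrier G" "\<forall>x\<in>B. a' B x = g \<otimes>\<^bsub>G\<^esub> a B x"
        using eq by blast
      have "\<forall>x\<in>B. a B x = inv\<^bsub>G\<^esub> g \<otimes>\<^bsub>G\<^esub> a' B x"
        using g gpartition_labelD[OF mem(1) B] by (simp add: m_assoc[symmetric])
      then show "\<exists>g\<in>carrier G. \<forall>x\<in>B. a B x = g \<otimes>\<^bsub>G\<^esub> a' B x"
        using g(1) inv_closed by blast
    qed
    then show ?thesis using mem unfolding p gpartition_rel_def by simp
  qed
  have tr: "(p, r) \<in> gpartition_rel n G"
    if pq: "(p, q) \<in> gpartition_rel n G" and qr: "(q, r) \<in> gpartition_rel n G" for p q r
  proof -
    obtain Z P a a' a'' where p: "p = (Z, P, a)" "q = (Z, P, a')" "r = (Z, P, a'')"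
      and mem: "(Z, P, a) \<in> gpartitions n G" "(Z, P, a'') \<in> gpartitions n G"
      and eq: "\<forall>B\<in>P. \<exists>g\<in>carrier G. \<forall>x\<in>B. a' B x = g \<otimes>\<^bsub>G\<^esub> a B x"
      and eq': "\<forall>B\<in>P. \<exists>g\<in>carrier G. \<forall>x\<in>B. a'' B x = g \<otimes>\<^bsub>G\<^esub> a' B x"
      using pq qr unfolding gpartition_rel_def by auto
    have "\<forall>B\<in>P. \<exists>g\<in>carrier G. \<forall>x\<in>B. a'' B x = g \<otimes>\<^bsub>G\<^esub> a B x"
    proof
      fix B assume B: "B \<in> P"
      obtain g where g: "g \<in> carrier G" "\<forall>x\<in>B. a' B x = g \<otimes>\<^bsub>G\<^esub> a B x"
        using eq B by blast
      obtain h where h: "h \<in> carrier G" "\<forall>x\<in>B. a'' B x = h \<otimes>\<^bsub>G\<^esub> a' B x"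
        using eq' B by blast
      have "\<forall>x\<in>B. a'' B x = (h \<otimes>\<^bsub>G\<^esub> g) \<otimes>\<^bsub>G\<^esub> a B x"
        using g h gpartition_labelD[OF mem(1) B] by (simp add: m_assoc)
      then show "\<exists>g\<in>carrier G. \<forall>x\<in>B. a'' B x = g \<otimes>\<^bsub>G\<^esub> a B x"
        using g(1) h(1) m_closed by blast
    qed
    then show ?thesis using mem unfolding p gpartition_rel_def by simp
  qed
  have sub: "gpartition_rel n G \<subseteq> gpartitions n G \<times> gpartitions n G"
    unfolding gpartition_rel_def by auto
  show ?thesis
  proof (rule equivI)
    show "gpartition_rel n G \<subseteq> gpartitions n G \<times> gpartitions n G" by (rule sub)
    show "refl_on (gpartitions n G) (gpartition_rel n G)" by (rule refl_onI) (rule rfl)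
    show "sym (gpartition_rel n G)" by (rule symI) (rule sm)
    show "trans (gpartition_rel n G)" by (rule transI) (rule tr)
  qed
qed

lemma gpartition_le_cong:
  assumes "group G"
    and pp: "(p, p') \<in> gpartition_rel n G" and qq: "(q, q') \<in> gpartition_rel n G"
    and le: "gpartition_le G p q"
  shows "gpartition_le G p' q'"
proof -
  interpret group G by fact
  have pp': "(p', p) \<in> gpartition_rel n G"
    using pp equiv_gpartition_rel[OF \<open>group G\<close>] by (meson equiv_def symD)
  obtain Z P a a' where p: "p = (Z, P, a)" "p' = (Z, P, a')"
    and mem: "(Z, P, a) \<in> gpartitions n G" "(Z, P, a') \<in> gpartitions n G"
    and eq: "\<forall>B\<in>P. \<exists>g\<in>carrier G. \<forall>x\<in>B. a B x = g \<otimes>\<^bsub>G\<^esub> a' B x"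
    using pp' unfolding gpartition_rel_def by auto
  obtain Y Q b b' where q: "q = (Y, Q, b)" "q' = (Y, Q, b')"
    and eqb: "\<forall>C\<in>Q. \<exists>g\<in>carrier G. \<forall>x\<in>C. b' C x = g \<otimes>\<^bsub>G\<^esub> b C x"
    using qq unfolding gpartition_rel_def by auto
  have leD: "\<exists>g\<in>carrier G. \<forall>x\<in>B. b C x = g \<otimes>\<^bsub>G\<^esub> a B x"
    if "C \<in> Q" "B \<in> P" "B \<subseteq> C" for C B
    using le that unfolding p q gpartition_le_def by simp
  have "\<exists>g\<in>carrier G. \<forall>x\<in>B. b' C x = g \<otimes>\<^bsub>G\<^esub> a' B x" if C: "C \<in> Q" and B: "B \<in> P" "B \<subseteq> C" for C B
  proof -
    obtain g where g: "g \<in> carrier G" "\<forall>x\<in>B. a B x = g \<otimes>\<^bsub>G\<^esub> a' B x"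
      using eq B by blast
    obtain h where h: "h \<in> carrier G" "\<forall>x\<in>B. b C x = h \<otimes>\<^bsub>G\<^esub> a B x"
      using leD[OF C B] by blast
    obtain k where k: "k \<in> carrier G" "\<forall>x\<in>C. b' C x = k \<otimes>\<^bsub>G\<^esub> b C x"
      using eqb C by blast
    have "\<forall>x\<in>B. b' C x = (k \<otimes>\<^bsub>G\<^esub> (h \<otimes>\<^bsub>G\<^esub> g)) \<otimes>\<^bsub>G\<^esub> a' B x"
      using g h k B(2) gpartition_labelD[OF mem(2) B(1)] by (simp add: m_assoc subset_iff)
    then show ?thesis using g(1) h(1) k(1) m_closed by blast
  qed
  then show ?thesis using le unfolding p q gpartition_le_def by simp
qed

end

theory Submission
  imports Defs
begin

text \<open>
  A dependent triple of points of a simple transversal matroid meets only two members of the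
  covering, so it lies in some \<open>E(x)\<close>. As \<open>k = 1\<close>, every line with at least three points is
  therefore the same set \<open>E\<close>, and the bound on the number of lines says that such a line exists.
  A point outside \<open>E\<close> lies on \<open>m - 1\<close> lines and a point of \<open>E\<close> on \<open>1 + m - |E| < m - 1\<close> lines, so
  uniformity forces \<open>E = U\<close>. Hence \<open>L(\<C>)\<close> consists of a bottom, a top and \<open>m\<close> pairwise
  incomparable elements in between, and so does \<open>Q\<^sub>2(G)\<close> when \<open>m = |G| + 2\<close>.
\<close>

section \<open>Bounded antichains\<close>

text \<open>With \<open>A\<close> empty this is the two-element chain, the shape of
  \<open>Q_1(G)\<close>; with \<open>A\<close> nonempty it is a lattice of rank two. The one-element
  lattice is excluded by \<open>b \<noteq> t\<close>, so \<open>n = 0\<close> is treated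
  separately.\<close>

definition bounded_antichain :: "('a, 'c) gorder_scheme \<Rightarrow> 'a \<Rightarrow> 'a \<Rightarrow> 'a set \<Rightarrow> bool" where
  "bounded_antichain L b t A \<longleftrightarrow>
     carrier L = insert b (insert t A) \<and> b \<noteq> t \<and> b \<notin> A \<and> t \<notin> A \<and>
     (\<forall>x\<in>carrier L. \<forall>y\<in>carrier L. x \<sqsubseteq>\<^bsub>L\<^esub> y \<longleftrightarrow> x = b \<or> y = t \<or> x = y)"

text \<open>The order is determined by bottom, top and equality, so any bijection between the middle
  parts extends to an isomorphism. Comparing two such lattices thus reduces to counting
  \<open>A\<close>.\<close>

lemma bounded_antichain_isomorphic:
  assumes L: "bounded_antichain L b t A" and M: "bounded_antichain M b' t' A'"
    and fin: "finite A" "finite A'" and card: "card A = card A'"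
  shows "order_isomorphic L M"
proof -
  obtain h where h: "bij_betw h A A'"
    using finite_same_card_bij[OF fin card] by blast
  define f where "f x = (if x = b then b' else if x = t then t' else h x)" for x
  have hA: "h x \<in> A'" if "x \<in> A" for x
    using h that by (auto simp: bij_betw_def)
  have hinj: "h x = h y \<longleftrightarrow> x = y" if "x \<in> A" "y \<in> A" for x y
    using h that by (auto simp: bij_betw_def inj_on_def)
  note LD = L[unfolded bounded_antichain_def]
  note MD = M[unfolded bounded_antichain_def]
  have inj: "f x = f y \<longleftrightarrow> x = y" if "x \<in> carrier L" "y \<in> carrier L" for x y
    using that LD MD hA hinj unfolding f_def by (smt (verit) insert_iff)
  \<comment> \<open>Since \<open>f b = b'\<close> and \<open>f t = t'\<close>, these are instances
    of injectivity; they translate the description of the order on \<open>M\<close> back to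
    \<open>L\<close>.\<close>
  have fb: "f x = b' \<longleftrightarrow> x = b" and ft: "f x = t' \<longleftrightarrow> x = t" if "x \<in> carrier L" for x
    using inj[of x b] inj[of x t] that LD by (auto simp: f_def)
  have fA: "f ` A = A'"
  proof -
    have "f ` A = h ` A"
      using LD by (intro image_cong) (auto simp: f_def)
    then show ?thesis using h by (simp add: bij_betw_def)
  qed
  have img: "f ` carrier L = carrier M"
  proof -
    have "f b = b'" "f t = t'" using LD by (auto simp: f_def)
    then show ?thesis using LD MD fA by simp
  qed
  have "bij_betw f (carrier L) (carrier M)"
    using inj img by (auto simp: bij_betw_def inj_on_def)
  moreover have "x \<sqsubseteq>\<^bsub>L\<^esub> y \<longleftrightarrow> f x \<sqsubseteq>\<^bsub>M\<^esub> f y" if xy: "x \<in> carrier L" "y \<in> carrier L" for x y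
  proof -
    have "f x \<in> carrier M" "f y \<in> carrier M" using img xy by auto
    then have "f x \<sqsubseteq>\<^bsub>M\<^esub> f y \<longleftrightarrow> f x = b' \<or> f y = t' \<or> f x = f y"
      using MD by blast
    also have "\<dots> \<longleftrightarrow> x = b \<or> y = t \<or> x = y"
      using fb ft inj xy by blast
    finally show ?thesis using LD xy by blast
  qed
  ultimately show ?thesis unfolding order_isomorphic_def by blast
qed

section \<open>Dowling lattices of rank at most two\<close>

definition gclass :: "nat \<Rightarrow> ('g, 'b) monoid_scheme \<Rightarrow> 'g gpartition \<Rightarrow> 'g gpartition set" where
  "gclass n G p = gpartition_rel n G `` {p}"

lemma carrier_dowling_lattice:
  "carrier (dowling_lattice n G) = gclass n G ` gpartitions n G"
  by (auto simp: dowling_lattice_def gclass_def quotient_def)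

lemma gclass_eq_iff:
  assumes "group G" "p \<in> gpartitions n G" "q \<in> gpartitions n G"
  shows "gclass n G p = gclass n G q \<longleftrightarrow> (p, q) \<in> gpartition_rel n G"
  unfolding gclass_def using equiv_gpartition_rel[OF assms(1)] assms(2,3) by (rule eq_equiv_class_iff)

text \<open>The order on classes asks for some pair of comparable representatives;
  \<open>gpartition_le_cong\<close> moves such a comparison to the given ones. All later comparisons
  can therefore be made on explicit triples.\<close>

lemma gclass_le_iff:
  assumes "group G" "p \<in> gpartitions n G" "q \<in> gpartitions n G"
  shows "gclass n G p \<sqsubseteq>\<^bsub>dowling_lattice n G\<^esub> gclass n G q \<longleftrightarrow> gpartition_le G p q"
proof -
  have refl: "r \<in> gclass n G r" if "r \<in> gpartitions n G" for r
    using that equiv_gpartition_rel[OF assms(1)] unfolding gclass_def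
    by (rule equiv_class_self[rotated])
  have sym: "(r, s) \<in> gpartition_rel n G" if "(s, r) \<in> gpartition_rel n G" for r s :: "'a gpartition"
    using that equiv_gpartition_rel[OF assms(1)] by (meson equiv_def symD)
  show ?thesis
  proof
    assume "gclass n G p \<sqsubseteq>\<^bsub>dowling_lattice n G\<^esub> gclass n G q"
    then obtain p' q' where "(p, p') \<in> gpartition_rel n G" "(q, q') \<in> gpartition_rel n G"
      "gpartition_le G p' q'"
      by (auto simp: dowling_lattice_def gclass_def)
    then show "gpartition_le G p q"
      using gpartition_le_cong[OF assms(1)] sym by blast
  next
    assume "gpartition_le G p q"
    then show "gclass n G p \<sqsubseteq>\<^bsub>dowling_lattice n G\<^esub> gclass n G q"
      using refl[OF assms(2)] refl[OF assms(3)] unfolding dowling_lattice_def gorder.simps by blast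
  qed
qed

text \<open>One function \<open>f\<close> labels all blocks at once; the two restrictions produce
  the extensional functions that \<open>gpartitions\<close> demands.\<close>

definition labeled :: "nat set \<Rightarrow> nat set set \<Rightarrow> (nat \<Rightarrow> 'g) \<Rightarrow> 'g gpartition" where
  "labeled Z P f = (Z, P, \<lambda>B\<in>P. \<lambda>x\<in>B. f x)"

lemma labeled_in_gpartitions:
  assumes "Z \<subseteq> {1..n}" "partition_on ({1..n} - Z) P" "\<And>x. f x \<in> carrier G"
  shows "labeled Z P f \<in> gpartitions n G"
  using assms by (auto simp: labeled_def gpartitions_def)

text \<open>On a one-point block, left multiplication by the quotient of the two labels carries one
  labeling to the other, so labels of such blocks carry no information. The case
  \<open>P = {}\<close> is included.\<close>

lemma gclass_singleton_blocks:
  assumes G: "group G" and p: "(Z, P, a) \<in> gpartitions n G" and q: "(Z, P, b) \<in> gpartitions n G"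
    and sing: "\<And>B. B \<in> P \<Longrightarrow> is_singleton B"
  shows "gclass n G (Z, P, a) = gclass n G (Z, P, b)"
proof -
  interpret group G by fact
  have "\<exists>g\<in>carrier G. \<forall>x\<in>B. b B x = g \<otimes>\<^bsub>G\<^esub> a B x" if B: "B \<in> P" for B
  proof -
    obtain x where x: "B = {x}" using sing[OF B] by (auto simp: is_singleton_def)
    have "a B x \<in> carrier G" "b B x \<in> carrier G"
      using gpartition_labelD[OF p B] gpartition_labelD[OF q B] x by auto
    then show ?thesis
      using x by (intro bexI[of _ "b B x \<otimes>\<^bsub>G\<^esub> inv\<^bsub>G\<^esub> a B x"]) (auto simp: m_assoc)
  qed
  then show ?thesis
    using p q by (simp add: gclass_eq_iff[OF G p q] gpartition_rel_def)
qed

text \<open>The zero block \<open>{1..n}\<close> leaves no nonzero block on the larger side, so the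
  conditions on blocks are vacuous.\<close>

lemma gpartition_le_top: "(Z, P, a) \<in> gpartitions n G \<Longrightarrow> gpartition_le G (Z, P, a) ({1..n}, {}, b)"
  by (auto simp: gpartition_le_def gpartitions_def)

text \<open>Every block is the union of the singletons of its points, and on a single point the
  quotient of the two labels is the required group element.\<close>

lemma gpartition_le_singletons:
  assumes G: "group G" and q: "(Z, Q, b) \<in> gpartitions n G"
    and p: "({}, (\<lambda>x. {x}) ` {1..n}, a) \<in> gpartitions n G"
  shows "gpartition_le G ({}, (\<lambda>x. {x}) ` {1..n}, a) (Z, Q, b)"
proof -
  interpret group G by fact
  have QN: "C \<subseteq> {1..n}" if "C \<in> Q" for C
    using q that by (auto simp: gpartitions_def partition_on_def)
  have "\<exists>S\<subseteq>(\<lambda>x. {x}) ` {1..n}. C = \<Union>S" if "C \<in> Q" for C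
    using QN[OF that] by (intro exI[of _ "(\<lambda>x. {x}) ` C"]) auto
  moreover have "\<exists>g\<in>carrier G. \<forall>y\<in>{x}. b C y = g \<otimes>\<^bsub>G\<^esub> a {x} y"
    if "C \<in> Q" "x \<in> {1..n}" "{x} \<subseteq> C" for C x
  proof -
    have "a {x} x \<in> carrier G" "b C x \<in> carrier G"
      using gpartition_labelD[OF p, of "{x}" x] gpartition_labelD[OF q, of C x] that by auto
    then show ?thesis
      by (intro bexI[of _ "b C x \<otimes>\<^bsub>G\<^esub> inv\<^bsub>G\<^esub> a {x} x"]) (auto simp: m_assoc)
  qed
  ultimately show ?thesis unfolding gpartition_le_def by auto
qed

section \<open>Set partitions of at most two points\<close>

lemma partition_on_empty_iff: "partition_on {} P \<longleftrightarrow> P = {}"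
  by (auto simp: partition_on_def)

lemma partition_on_singleton_iff: "partition_on {x} P \<longleftrightarrow> P = {{x}}"
proof
  assume "partition_on {x} P"
  then have P: "\<Union>P = {x}" "{} \<notin> P" by (auto simp: partition_on_def)
  then have "B = {x}" if "B \<in> P" for B
    using that by (metis Union_upper subset_singletonD)
  moreover have "P \<noteq> {}" using P(1) by auto
  ultimately show "P = {{x}}" by blast
qed (auto simp: partition_on_def disjoint_def)

text \<open>If the whole pair is a block, disjointness leaves no room for another one. Otherwise
  only the two singletons can be blocks, and both are needed to cover the pair.\<close>

lemma partition_on_doubleton_iff:
  assumes "x \<noteq> y"
  shows "partition_on {x, y} P \<longleftrightarrow> P = {{x}, {y}} \<or> P = {{x, y}}"
proof
  assume P: "partition_on {x, y} P"
  then have U: "\<Union>P = {x, y}" and ne: "{} \<notin> P" and dis: "disjoint P"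
    by (auto simp: partition_on_def)
  have sub: "B = {x} \<or> B = {y} \<or> B = {x, y}" if "B \<in> P" for B
  proof -
    have "B \<subseteq> {x, y}" "B \<noteq> {}" using U ne that by auto
    then show ?thesis by auto
  qed
  have meet: "B = C" if "B \<in> P" "C \<in> P" "B \<inter> C \<noteq> {}" for B C
    using dis that by (auto simp: disjoint_def)
  show "P = {{x}, {y}} \<or> P = {{x, y}}"
  proof (cases "{x, y} \<in> P")
    case True
    then have "P = {{x, y}}" using sub meet[OF True] by blast
    then show ?thesis ..
  next
    case False
    then have "P \<subseteq> {{x}, {y}}" using sub by blast
    moreover obtain B C where "B \<in> P" "x \<in> B" "C \<in> P" "y \<in> C" using U by blast
    moreover have "{x} \<in> P" "{y} \<in> P" using calculation assms by auto
    ultimately show ?thesis by blast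
  qed
qed (use assms in \<open>auto simp: partition_on_def disjoint_def\<close>)

section \<open>The Dowling lattices for n = 0, 1, 2\<close>

lemma dowling_lattice_0:
  assumes G: "group G"
  obtains p where "carrier (dowling_lattice 0 G) = {p}" "p \<sqsubseteq>\<^bsub>dowling_lattice 0 G\<^esub> p"
proof -
  \<comment> \<open>The only extensional function on the empty set of blocks is constantly
    \<open>undefined\<close>.\<close>
  have "gpartitions 0 G = {({}, {}, \<lambda>_. undefined)}"
    by (auto simp: gpartitions_def partition_on_empty_iff)
  then have "carrier (dowling_lattice 0 G) = {gclass 0 G ({}, {}, \<lambda>_. undefined)}"
    "gclass 0 G ({}, {}, \<lambda>_. undefined) \<sqsubseteq>\<^bsub>dowling_lattice 0 G\<^esub> gclass 0 G ({}, {}, \<lambda>_. undefined)"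
    by (simp_all add: carrier_dowling_lattice gclass_le_iff[OF G] gpartition_le_def)
  then show ?thesis by (rule that)
qed

text \<open>The point 1 either forms a nonzero block, whose label does not matter, or lies in the
  zero block; nothing lies in between.\<close>

lemma dowling_lattice_1:
  assumes G: "group G"
  obtains b t where "bounded_antichain (dowling_lattice 1 G) b t {}"
proof -
  interpret group G by fact
  define p where "p = labeled {} {{1}} (\<lambda>_. \<one>\<^bsub>G\<^esub>)"
  define q where "q = labeled {1} {} (\<lambda>_. \<one>\<^bsub>G\<^esub>)"
  have p: "p \<in> gpartitions 1 G" and q: "q \<in> gpartitions 1 G"
    unfolding p_def q_def
    by (rule labeled_in_gpartitions; simp add: partition_on_empty_iff partition_on_singleton_iff)+
  have cases: "gclass 1 G r = gclass 1 G p \<or> gclass 1 G r = gclass 1 G q" if r: "r \<in> gpartitions 1 G" for r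
  proof -
    obtain Z P a where r': "r = (Z, P, a)" by (cases r)
    have "Z \<subseteq> {1}" and P: "partition_on ({1} - Z) P"
      using r unfolding r' gpartitions_def by auto
    then consider "Z = {}" | "Z = {1}" by blast
    then show ?thesis
    proof cases
      case 1
      then have PE: "P = {{1}}" using P by (simp add: partition_on_singleton_iff)
      have "gclass 1 G r = gclass 1 G p" using r p unfolding r' p_def labeled_def 1 PE
        by (rule gclass_singleton_blocks[OF G]) auto
      then show ?thesis ..
    next
      case 2
      then have PE: "P = {}" using P by (simp add: partition_on_empty_iff)
      have "gclass 1 G r = gclass 1 G q" using r q unfolding r' q_def labeled_def 2 PE
        by (rule gclass_singleton_blocks[OF G]) auto
      then show ?thesis ..
    qed
  qed
  have car: "carrier (dowling_lattice 1 G) = {gclass 1 G p, gclass 1 G q}"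
    using cases p q by (auto simp: carrier_dowling_lattice)
  have refl: "gpartition_le G p p" "gpartition_le G q q"
    using gpartition_le_singletons[OF G, of "{}" "{{1}}" _ 1] p q unfolding p_def q_def labeled_def
    by (auto simp: gpartition_le_def)
  moreover have "gpartition_le G p q" "\<not> gpartition_le G q p"
    by (simp_all add: p_def q_def labeled_def gpartition_le_def)
  moreover have "gclass 1 G p \<noteq> gclass 1 G q"
    unfolding gclass_eq_iff[OF G p q] by (simp add: p_def q_def labeled_def gpartition_rel_def)
  ultimately have "bounded_antichain (dowling_lattice 1 G) (gclass 1 G p) (gclass 1 G q) {}"
    unfolding bounded_antichain_def car
    by (simp add: gclass_le_iff[OF G p p] gclass_le_iff[OF G p q] gclass_le_iff[OF G q p]
        gclass_le_iff[OF G q q] del: One_nat_def)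
  then show ?thesis by (rule that)
qed

text \<open>Between bottom and top lie the two classes with a one-point zero block and one class for
  each group element: a labeling of the block \<open>{1, 2}\<close> is determined, up to a left
  factor, by the inverse of its value at 1 times its value at 2.\<close>

lemma dowling_lattice_2:
  assumes G: "group G" and fin: "finite (carrier G)"
  obtains b t A where "bounded_antichain (dowling_lattice 2 G) b t A" "finite A" "card A = order G + 2"
proof -
  interpret group G by fact
  let ?c = "gclass 2 G"
  define bt where "bt = labeled {} {{1}, {2}} (\<lambda>_. \<one>\<^bsub>G\<^esub>)"
  define tp where "tp = labeled {1, 2} {} (\<lambda>_. \<one>\<^bsub>G\<^esub>)"
  define z1 where "z1 = labeled {1} {{2}} (\<lambda>_. \<one>\<^bsub>G\<^esub>)"
  define z2 where "z2 = labeled {2} {{1}} (\<lambda>_. \<one>\<^bsub>G\<^esub>)"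
  \<comment> \<open>The representative is normalized to the label one at the point 1. The default
    one for \<open>g\<close> outside the group makes \<open>d g\<close> a valid partial partition
    for every \<open>g\<close>, so membership needs no side condition.\<close>
  define d where "d g = labeled {} {{1, 2}} (\<lambda>x. if x = 1 then \<one>\<^bsub>G\<^esub> else if g \<in> carrier G then g else \<one>\<^bsub>G\<^esub>)" for g
  note defs = bt_def tp_def z1_def z2_def d_def labeled_def
  have N: "{1..2} = {1, 2::nat}" by auto
  have N1: "{1, 2} - {1::nat} = {2}" "{1, 2} - {2::nat} = {1}" by auto
  note part = partition_on_empty_iff partition_on_singleton_iff partition_on_doubleton_iff
  have mem: "bt \<in> gpartitions 2 G" "tp \<in> gpartitions 2 G" "z1 \<in> gpartitions 2 G"
    "z2 \<in> gpartitions 2 G" "d g \<in> gpartitions 2 G" for g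
    unfolding bt_def tp_def z1_def z2_def d_def
    by (rule labeled_in_gpartitions; simp add: N N1 part del: One_nat_def)+
  have cases: "?c r \<in> {?c bt, ?c tp, ?c z1, ?c z2} \<union> (\<lambda>g. ?c (d g)) ` carrier G"
    if r: "r \<in> gpartitions 2 G" for r
  proof -
    obtain Z P a where r': "r = (Z, P, a)" by (cases r)
    have "Z \<subseteq> {1, 2}" and P: "partition_on ({1, 2} - Z) P"
      using r unfolding r' gpartitions_def N by auto
    then consider "Z = {}" "P = {{1}, {2}}" | "Z = {1, 2}" "P = {}" | "Z = {1}" "P = {{2}}"
      | "Z = {2}" "P = {{1}}" | "Z = {}" "P = {{1, 2}}"
    proof -
      have "Z = {} \<or> Z = {1, 2} \<or> Z = {1} \<or> Z = {2}" using \<open>Z \<subseteq> {1, 2}\<close> by blast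
      then show ?thesis using P that by (elim disjE) (simp_all add: N1 part del: One_nat_def, blast)
    qed
    then show ?thesis
    proof cases
      case 1
      have "?c r = ?c bt" using r mem(1) unfolding r' bt_def labeled_def 1
        by (rule gclass_singleton_blocks[OF G]) auto
      then show ?thesis by simp
    next
      case 2
      have "?c r = ?c tp" using r mem(2) unfolding r' tp_def labeled_def 2
        by (rule gclass_singleton_blocks[OF G]) auto
      then show ?thesis by simp
    next
      case 3
      have "?c r = ?c z1" using r mem(3) unfolding r' z1_def labeled_def 3
        by (rule gclass_singleton_blocks[OF G]) auto
      then show ?thesis by simp
    next
      case 4
      have "?c r = ?c z2" using r mem(4) unfolding r' z2_def labeled_def 4
        by (rule gclass_singleton_blocks[OF G]) auto
      then show ?thesis by simp
    next
      case 5
      let ?B = "{1, 2::nat}"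
      have a: "a ?B 1 \<in> carrier G" "a ?B 2 \<in> carrier G"
        using gpartition_labelD[OF r[unfolded r'], of ?B] 5 by auto
      \<comment> \<open>This ratio is unchanged by left multiplication, and multiplying by the
        inverse of the label at 1 turns \<open>a\<close> into the labeling of
        \<open>d g\<close>.\<close>
      define g where "g = inv\<^bsub>G\<^esub> a ?B 1 \<otimes>\<^bsub>G\<^esub> a ?B 2"
      have g: "g \<in> carrier G" using a by (simp add: g_def)
      have "(r, d g) \<in> gpartition_rel 2 G"
        using r mem(5)[of g] g a unfolding r' 5 d_def labeled_def gpartition_rel_def
        by (auto simp: g_def intro!: bexI[of _ "inv\<^bsub>G\<^esub> a ?B 1"] simp del: One_nat_def)
      then have "?c r = ?c (d g)" using gclass_eq_iff[OF G r mem(5)] by simp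
      then show ?thesis using g by blast
    qed
  qed
  let ?A = "{?c z1, ?c z2} \<union> (\<lambda>g. ?c (d g)) ` carrier G"
  have car: "carrier (dowling_lattice 2 G) = insert (?c bt) (insert (?c tp) ?A)"
    using cases mem unfolding carrier_dowling_lattice by blast
  have ceq: "?c p = ?c q \<longleftrightarrow> (p, q) \<in> gpartition_rel 2 G"
    if "p \<in> gpartitions 2 G" "q \<in> gpartitions 2 G" for p q
    using gclass_eq_iff[OF G that] .
  have neq: "?c bt \<noteq> ?c tp" "?c bt \<noteq> ?c z1" "?c bt \<noteq> ?c z2" "?c bt \<noteq> ?c (d g)"
    "?c tp \<noteq> ?c z1" "?c tp \<noteq> ?c z2" "?c tp \<noteq> ?c (d g)" "?c z1 \<noteq> ?c z2" "?c z1 \<noteq> ?c (d g)"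
    "?c z2 \<noteq> ?c (d g)" for g
    unfolding ceq[OF mem(1) mem(2)] ceq[OF mem(1) mem(3)] ceq[OF mem(1) mem(4)] ceq[OF mem(1) mem(5)]
      ceq[OF mem(2) mem(3)] ceq[OF mem(2) mem(4)] ceq[OF mem(2) mem(5)] ceq[OF mem(3) mem(4)]
      ceq[OF mem(3) mem(5)] ceq[OF mem(4) mem(5)]
    by (auto simp: defs gpartition_rel_def doubleton_eq_iff)
  \<comment> \<open>Comparing labels at the point 1 forces the multiplier to be one, and then the
    labels at the point 2 must agree.\<close>
  have dle: "gpartition_le G (d g) (d h) \<longleftrightarrow> g = h" if g: "g \<in> carrier G" and h: "h \<in> carrier G" for g h
    using g h by (auto simp: defs gpartition_le_def simp del: One_nat_def)
  have dinj: "?c (d g) = ?c (d h) \<longleftrightarrow> g = h" if "g \<in> carrier G" "h \<in> carrier G" for g h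
  proof
    assume "?c (d g) = ?c (d h)"
    then have "?c (d g) \<sqsubseteq>\<^bsub>dowling_lattice 2 G\<^esub> ?c (d h)"
      using dle[OF that(1) that(1)] gclass_le_iff[OF G mem(5) mem(5)] by metis
    then show "g = h" using dle[OF that] by (simp add: gclass_le_iff[OF G mem(5) mem(5)])
  qed simp
  have sing: "(\<lambda>x. {x}) ` {1..2} = {{1}, {2::nat}}" by (auto simp: N)
  have le_bt: "gpartition_le G bt p" if "p \<in> gpartitions 2 G" for p
    using gpartition_le_singletons[OF G, where n=2, unfolded sing] that mem(1)
    unfolding bt_def labeled_def by (cases p) auto
  have le_tp: "gpartition_le G p tp" if "p \<in> gpartitions 2 G" for p
    using gpartition_le_top[where n=2, unfolded N] that unfolding tp_def labeled_def by (cases p) auto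
  \<comment> \<open>In each of these pairs the inclusion of zero blocks already fails.\<close>
  have nle: "\<not> gpartition_le G tp bt" "\<not> gpartition_le G tp z1" "\<not> gpartition_le G tp z2"
    "\<not> gpartition_le G tp (d g)" "\<not> gpartition_le G z1 bt" "\<not> gpartition_le G z2 bt"
    "\<not> gpartition_le G z1 z2" "\<not> gpartition_le G z2 z1" "\<not> gpartition_le G z1 (d g)"
    "\<not> gpartition_le G z2 (d g)" for g
    by (simp_all add: defs gpartition_le_def)
  \<comment> \<open>A partition with a singleton block cannot lie above \<open>d g\<close>, whose
    only nonzero block is the whole pair.\<close>
  have no_union: "\<not> (\<exists>S\<subseteq>{{1, 2::nat}}. {i} = \<Union>S)" for i
  proof
    assume "\<exists>S\<subseteq>{{1, 2::nat}}. {i} = \<Union>S"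
    then obtain S where "S = {} \<or> S = {{1, 2::nat}}" "{i} = \<Union>S" by (auto dest: subset_singletonD)
    then show False by (elim disjE) auto
  qed
  have nle2: "\<not> gpartition_le G (d g) bt" "\<not> gpartition_le G (d g) z1" "\<not> gpartition_le G (d g) z2" for g
    unfolding defs gpartition_le_def using no_union[of 1] no_union[of 2] by (simp_all del: One_nat_def)
  have rle: "gpartition_le G z1 z1" "gpartition_le G z2 z2"
    by (auto simp: defs gpartition_le_def)
  have "\<forall>x\<in>carrier (dowling_lattice 2 G). \<forall>y\<in>carrier (dowling_lattice 2 G).
      x \<sqsubseteq>\<^bsub>dowling_lattice 2 G\<^esub> y \<longleftrightarrow> x = ?c bt \<or> y = ?c tp \<or> x = y"
    unfolding car
    using neq neq[symmetric] nle nle2 rle le_bt le_tp dle dinj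
    by (auto simp: gclass_le_iff[OF G] mem)
  then have "bounded_antichain (dowling_lattice 2 G) (?c bt) (?c tp) ?A"
    unfolding bounded_antichain_def using neq car by auto
  moreover have "finite ?A" using fin by simp
  moreover have "card ?A = order G + 2"
  proof -
    have "inj_on (\<lambda>g. ?c (d g)) (carrier G)" by (simp add: inj_on_def dinj)
    then have "card ((\<lambda>g. ?c (d g)) ` carrier G) = order G" by (simp add: card_image order_def)
    moreover have "?c z1 \<notin> insert (?c z2) ((\<lambda>g. ?c (d g)) ` carrier G)"
      "?c z2 \<notin> (\<lambda>g. ?c (d g)) ` carrier G" using neq by auto
    ultimately show ?thesis using fin by simp
  qed
  ultimately show ?thesis by (rule that)
qed

section \<open>Flats of transversal matroids\<close>

lemma meeting_singleton: "meeting \<C> {e} = {C \<in> \<C>. e \<in> C}"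
  by (auto simp: meeting_def)

lemma partial_transversalI:
  assumes "I \<subseteq> U" "inj_on \<phi> I" "\<And>e. e \<in> I \<Longrightarrow> \<phi> e \<in> meeting \<C> {e}"
  shows "partial_transversal U \<C> I"
  using assms unfolding partial_transversal_def meeting_singleton by blast

lemma partial_transversalE:
  assumes "partial_transversal U \<C> I"
  obtains \<phi> where "I \<subseteq> U" "inj_on \<phi> I" "\<And>e. e \<in> I \<Longrightarrow> \<phi> e \<in> meeting \<C> {e}"
  using assms unfolding partial_transversal_def meeting_singleton by blast

lemma partial_transversal_empty: "partial_transversal U \<C> {}"
  by (simp add: partial_transversal_def)

text \<open>A numerical certificate: \<open>r\<close> bounds the rank of \<open>X\<close> from above
  and is exceeded as soon as an outside point is added. Finiteness and \<open>indep {}\<close>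
  ensure that the maxima defining the ranks exist.\<close>

lemma flatI:
  assumes fin: "finite U" and XU: "X \<subseteq> U"
    and empty: "indep {}"
    and le: "\<And>I. I \<subseteq> X \<Longrightarrow> indep I \<Longrightarrow> card I \<le> r"
    and gt: "\<And>e. e \<in> U - X \<Longrightarrow> \<exists>I\<subseteq>insert e X. indep I \<and> r < card I"
  shows "X \<in> flats U indep"
proof -
  have "matroid_rank indep (insert e X) \<noteq> matroid_rank indep X" if e: "e \<in> U - X" for e
  proof -
    have finX: "finite X" using fin XU by (rule finite_subset[rotated])
    have fins: "finite {card I |I. I \<subseteq> Y \<and> indep I}" if "finite Y" for Y
    proof (rule finite_subset)
      show "{card I |I. I \<subseteq> Y \<and> indep I} \<subseteq> card ` Pow Y" by blast
    qed (use that in simp)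
    have "matroid_rank indep X \<le> r"
      unfolding matroid_rank_def using fins[OF finX] empty le by (subst Max_le_iff) auto
    moreover obtain I where "I \<subseteq> insert e X" "indep I" "r < card I" using gt[OF e] by blast
    then have "r < matroid_rank indep (insert e X)"
      unfolding matroid_rank_def using fins[of "insert e X"] finX by (subst Max_gr_iff) auto
    ultimately show ?thesis by linarith
  qed
  moreover have "matroid_rank indep (insert e X) = matroid_rank indep X" if "e \<in> X" for e
    using that by (simp add: insert_absorb)
  ultimately show ?thesis
    unfolding flats_def matroid_closure_def using XU by auto
qed

text \<open>If independent sets using \<open>e\<close> can be replaced by equally large ones inside
  \<open>F\<close>, then adding \<open>e\<close> does not change the set of attained sizes, hence
  not the rank, and the closed set \<open>F\<close> must contain \<open>e\<close>.\<close>

lemma flat_memI: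
  assumes F: "F \<in> flats U indep" and e: "e \<in> U"
    and ex: "\<And>I. I \<subseteq> insert e F \<Longrightarrow> indep I \<Longrightarrow> \<exists>J\<subseteq>F. indep J \<and> card J = card I"
  shows "e \<in> F"
proof -
  have "{card I |I. I \<subseteq> insert e F \<and> indep I} = {card I |I. I \<subseteq> F \<and> indep I}"
  proof (intro subset_antisym subsetI)
    fix n assume "n \<in> {card I |I. I \<subseteq> insert e F \<and> indep I}"
    then obtain I where I: "I \<subseteq> insert e F" "indep I" "n = card I" by blast
    then obtain J where "J \<subseteq> F" "indep J" "card J = card I" using ex by blast
    then show "n \<in> {card I |I. I \<subseteq> F \<and> indep I}"
      using I(3) by (intro CollectI exI[of _ J]) simp
  qed blast
  then have "e \<in> matroid_closure U indep F"
    using e by (simp add: matroid_closure_def matroid_rank_def)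
  then show ?thesis using F by (simp add: flats_def)
qed

lemma card_doubletons:
  assumes "finite U"
  shows "card {{u, v} |u v. u \<in> U \<and> v \<in> U \<and> u \<noteq> v} = card U choose 2"
proof -
  have "{{u, v} |u v. u \<in> U \<and> v \<in> U \<and> u \<noteq> v} = {K. K \<subseteq> U \<and> card K = 2}"
    by (auto simp: card_2_iff)
  then show ?thesis using n_subsets[OF assms, of 2] by simp
qed

text \<open>This is Hall's theorem for three sets: the pairwise hypotheses rule out an obstruction
  by at most two of them, so the union of all three has to be too small. The proof exchanges
  representatives directly.\<close>

lemma three_representatives:
  assumes "\<exists>p\<in>A. \<exists>q\<in>B. p \<noteq> q" "\<exists>p\<in>A. \<exists>q\<in>D. p \<noteq> q" "\<exists>p\<in>B. \<exists>q\<in>D. p \<noteq> q"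
    and no: "\<not> (\<exists>p\<in>A. \<exists>q\<in>B. \<exists>r\<in>D. p \<noteq> q \<and> p \<noteq> r \<and> q \<noteq> r)"
  obtains p q where "p \<noteq> q" "A \<union> B \<union> D \<subseteq> {p, q}"
proof -
  obtain p q where pq: "p \<in> A" "q \<in> B" "p \<noteq> q" using assms(1) by blast
  have no: "\<not> (u \<in> A \<and> v \<in> B \<and> w \<in> D \<and> u \<noteq> v \<and> u \<noteq> w \<and> v \<noteq> w)" for u v w
    using no by blast
  have D: "D \<subseteq> {p, q}" using no[of p q] pq by auto
  have "A \<subseteq> {p, q}"
  proof
    fix r assume r: "r \<in> A"
    show "r \<in> {p, q}"
    proof (rule ccontr)
      assume "r \<notin> {p, q}"
      \<comment> \<open>With \<open>r\<close> representing \<open>A\<close> and \<open>q\<close>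
        representing \<open>B\<close>, the element \<open>p\<close> would be free for
        \<open>D\<close>. So \<open>D\<close> can only use \<open>q\<close>, and \<open>B\<close>
        has to supply some \<open>s\<close> other than \<open>q\<close>; one of \<open>r\<close> and
        \<open>p\<close> differs from \<open>s\<close> and completes a forbidden triple.\<close>
      then have "D \<subseteq> {q}" using D no[of r q] pq r by auto
      then obtain s where "s \<in> B" "s \<noteq> q" "q \<in> D" using assms(3) by blast
      then show False using no[of r s q] no[of p s q] pq r \<open>r \<notin> {p, q}\<close> by auto
    qed
  qed
  moreover have "B \<subseteq> {p, q}"
  proof
    fix r assume r: "r \<in> B"
    show "r \<in> {p, q}"
    proof (rule ccontr)
      assume "r \<notin> {p, q}"
      then have "D \<subseteq> {p}" using D no[of p r] pq r by auto
      then obtain s where "s \<in> A" "s \<noteq> p" "p \<in> D" using assms(2) by blast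
      then show False using no[of s r p] no[of s q p] pq r \<open>r \<notin> {p, q}\<close> by auto
    qed
  qed
  ultimately show ?thesis using that[OF pq(3)] D by blast
qed

text \<open>The covering condition excludes loops and \<open>simple\<close> excludes parallel
  points, so the transversal matroid is simple.\<close>

locale simple_covering =
  fixes U :: "'a set" and \<C> :: "'a set set"
  assumes finite_ground: "finite U" and covering: "covering U \<C>"
    and simple: "\<lbrakk>u \<in> U; v \<in> U; meeting \<C> {u} = meeting \<C> {v}; card (meeting \<C> {u}) = 1\<rbrakk> \<Longrightarrow> u = v"
begin

abbreviation "indep \<equiv> partial_transversal U \<C>"

abbreviation "L \<equiv> covering_lattice U \<C>"

lemma finite_subset_ground: "X \<subseteq> U \<Longrightarrow> finite X"
  using finite_ground finite_subset by blast

lemma flatsD: "F \<in> flats U indep \<Longrightarrow> F \<subseteq> U"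
  by (simp add: flats_def)

lemma meeting_nonempty: "u \<in> U \<Longrightarrow> meeting \<C> {u} \<noteq> {}"
  using covering by (auto simp: covering_def meeting_singleton)

text \<open>Two nonempty families without distinct representatives are one and the same singleton,
  which \<open>simple\<close> forbids.\<close>

lemma two_representatives:
  assumes "u \<in> U" "v \<in> U" "u \<noteq> v"
  shows "\<exists>p\<in>meeting \<C> {u}. \<exists>q\<in>meeting \<C> {v}. p \<noteq> q"
proof (rule ccontr)
  assume "\<not> ?thesis"
  then have eq: "p = q" if "p \<in> meeting \<C> {u}" "q \<in> meeting \<C> {v}" for p q
    using that by blast
  obtain p q where p: "p \<in> meeting \<C> {u}" "q \<in> meeting \<C> {v}"
    using meeting_nonempty assms by blast
  have "meeting \<C> {u} = {p}" "meeting \<C> {v} = {p}" using eq p by blast+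
  then show False using simple[OF assms(1,2)] assms(3) by simp
qed

lemma indep_singleton: "u \<in> U \<Longrightarrow> indep {u}"
  using meeting_nonempty[of u] by (auto intro!: partial_transversalI[of _ _ "\<lambda>_. SOME C. C \<in> meeting \<C> {u}"] simp: some_in_eq)

lemma indep_doubleton:
  assumes "u \<in> U" "v \<in> U"
  shows "indep {u, v}"
proof (cases "u = v")
  case False
  then obtain p q where "p \<in> meeting \<C> {u}" "q \<in> meeting \<C> {v}" "p \<noteq> q"
    using two_representatives assms by blast
  then show ?thesis using assms False
    by (intro partial_transversalI[of _ _ "\<lambda>e. if e = u then p else q"]) (auto simp: inj_on_def)
qed (use assms indep_singleton in simp)

text \<open>By \<open>three_representatives\<close> the three points meet only two members
  \<open>p\<close> and \<open>q\<close>. Each of \<open>{p}\<close> and \<open>{q}\<close> can be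
  the family of at most one point, so one of the three points meets both members, and its
  \<open>E_set\<close> contains the triple.\<close>

lemma dependent_triple:
  assumes abc: "a \<in> U" "b \<in> U" "c \<in> U" "a \<noteq> b" "a \<noteq> c" "b \<noteq> c" and dep: "\<not> indep {a, b, c}"
  obtains x where "x \<in> {a, b, c}" "card (meeting \<C> {x}) = 2" "{a, b, c} \<subseteq> E_set U \<C> x"
proof -
  have "\<not> (\<exists>p\<in>meeting \<C> {a}. \<exists>q\<in>meeting \<C> {b}. \<exists>r\<in>meeting \<C> {c}. p \<noteq> q \<and> p \<noteq> r \<and> q \<noteq> r)"
  proof
    assume "\<exists>p\<in>meeting \<C> {a}. \<exists>q\<in>meeting \<C> {b}. \<exists>r\<in>meeting \<C> {c}. p \<noteq> q \<and> p \<noteq> r \<and> q \<noteq> r"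
    then obtain p q r where pqr: "p \<in> meeting \<C> {a}" "q \<in> meeting \<C> {b}" "r \<in> meeting \<C> {c}"
      "p \<noteq> q" "p \<noteq> r" "q \<noteq> r" by blast
    have "indep {a, b, c}"
      using pqr abc by (intro partial_transversalI[of _ _ "\<lambda>e. if e = a then p else if e = b then q else r"])
        (auto simp: inj_on_def)
    then show False using dep by simp
  qed
  then obtain p q where pq: "p \<noteq> q"
    "meeting \<C> {a} \<union> meeting \<C> {b} \<union> meeting \<C> {c} \<subseteq> {p, q}"
    by (rule three_representatives[OF two_representatives[OF abc(1,2,4)]
          two_representatives[OF abc(1,3,5)] two_representatives[OF abc(2,3,6)]])
  have sub: "meeting \<C> {y} \<subseteq> {p, q}" if "y \<in> {a, b, c}" for y
    using pq that by blast
  have one: "meeting \<C> {y} = {p} \<or> meeting \<C> {y} = {q} \<or> meeting \<C> {y} = {p, q}"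
    if "y \<in> {a, b, c}" for y
  proof -
    have "meeting \<C> {y} \<noteq> {}" using meeting_nonempty that abc by blast
    then show ?thesis using sub[OF that] by blast
  qed
  have "\<exists>x\<in>{a, b, c}. meeting \<C> {x} = {p, q}"
  proof (rule ccontr)
    assume "\<not> ?thesis"
    then have pq_only: "meeting \<C> {y} = {p} \<or> meeting \<C> {y} = {q}" if "y \<in> {a, b, c}" for y
      using one[OF that] that by blast
    then have "card (meeting \<C> {y}) = 1" if "y \<in> {a, b, c}" for y
      using that by fastforce
    then have "meeting \<C> {a} \<noteq> meeting \<C> {b}" "meeting \<C> {a} \<noteq> meeting \<C> {c}"
      "meeting \<C> {b} \<noteq> meeting \<C> {c}"
      using simple abc by blast+
    then show False using pq_only[of a] pq_only[of b] pq_only[of c] by auto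
  qed
  then obtain x where x: "x \<in> {a, b, c}" "meeting \<C> {x} = {p, q}" by blast
  show ?thesis
    by (rule that[OF x(1)]) (use x pq sub abc in \<open>auto simp: E_set_def\<close>)
qed

text \<open>The points \<open>x\<close> and \<open>y\<close> already account for both members of
  \<open>S\<close>, so adding \<open>e\<close> cannot raise the rank of \<open>F\<close>: in an
  independent set, \<open>e\<close> can be exchanged for \<open>x\<close> or
  \<open>y\<close>.\<close>

lemma flat_memI_span:
  assumes F: "F \<in> flats U indep" and xy: "x \<in> F" "y \<in> F" "x \<noteq> y"
    and S: "card S = 2" "meeting \<C> {x} \<subseteq> S" "meeting \<C> {y} \<subseteq> S"
    and e: "e \<in> U" "meeting \<C> {e} \<subseteq> S"
  shows "e \<in> F"
proof (rule ccontr)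
  assume eF: "e \<notin> F"
  have U: "F \<subseteq> U" using flatsD[OF F] .
  obtain p q where pq: "p \<in> meeting \<C> {x}" "q \<in> meeting \<C> {y}" "p \<noteq> q"
    using two_representatives xy U by blast
  have Spq: "S = {p, q}"
  proof -
    have "finite S" using S(1) by (simp add: card_ge_0_finite)
    moreover have "{p, q} \<subseteq> S" using S pq by blast
    ultimately show ?thesis using S(1) pq(3) by (metis card_2_iff card_subset_eq)
  qed
  have "e \<in> F"
  proof (rule flat_memI[OF F e(1)])
    fix I assume I: "I \<subseteq> insert e F" "indep I"
    show "\<exists>J\<subseteq>F. indep J \<and> card J = card I"
    proof (cases "e \<in> I")
      case False
      then show ?thesis using I by blast
    next
      case True
      obtain \<phi> where phi: "I \<subseteq> U" "inj_on \<phi> I" "\<And>e. e \<in> I \<Longrightarrow> \<phi> e \<in> meeting \<C> {e}"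
        using partial_transversalE[OF I(2)] by blast
      define K where "K = I - {e}"
      have finI: "finite I" using phi(1) by (rule finite_subset_ground)
      have K: "K \<subseteq> F" "finite K" "K \<subseteq> U"
        using I phi(1) finI by (auto simp: K_def)
      have card_K: "card I = Suc (card K)"
        using card_Suc_Diff1[OF finI True] by (simp add: K_def)
      have inj: "\<phi> u = \<phi> v \<Longrightarrow> u = v" if "u \<in> I" "v \<in> I" for u v
        using phi(2) that by (auto simp: inj_on_def)
      have pe: "\<phi> e \<in> {p, q}" using phi(3)[OF True] e(2) Spq by blast
      have card_J: "card (insert z K) = card I" if "z \<notin> I" for z
        using that K(2) card_K by (simp add: K_def)
      consider "x \<in> I" "y \<in> I" | "x \<in> I" "y \<notin> I" | "x \<notin> I" "y \<in> I" | "x \<notin> I" "y \<notin> I" by blast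
      then show ?thesis
      proof cases
        case 1
        \<comment> \<open>Impossible case: three distinct points would be sent injectively into
          \<open>{p, q}\<close>.\<close>
        have "\<phi> x \<in> {p, q}" "\<phi> y \<in> {p, q}"
          using phi(3)[OF 1(1)] phi(3)[OF 1(2)] S(2,3) Spq by auto
        then show ?thesis using pe inj[OF 1] inj[OF 1(1) True] inj[OF 1(2) True] xy eF by auto
      next
        case 2
        \<comment> \<open>The points \<open>x\<close> and \<open>e\<close> occupy both
          \<open>p\<close> and \<open>q\<close>, so all others avoid them. Dropping \<open>e\<close>
          lets \<open>x\<close> and \<open>y\<close> be reassigned to \<open>p\<close> and
          \<open>q\<close>. The next case is symmetric.\<close>
        have "\<phi> x \<in> {p, q}" using phi(3)[OF 2(1)] S(2,3) Spq by auto
        moreover have "\<phi> x \<noteq> \<phi> e" using inj[OF 2(1) True] xy eF by auto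
        moreover have "\<phi> z \<noteq> \<phi> x" "\<phi> z \<noteq> \<phi> e" if "z \<in> K" "z \<noteq> x" for z
          using inj[of z x] inj[of z e] 2(1) True that by (auto simp: K_def)
        ultimately have other: "\<phi> z \<notin> {p, q}" if "z \<in> K" "z \<noteq> x" for z
          using that pe by auto
        have "indep (insert y K)"
        proof (rule partial_transversalI[where \<phi>="\<phi>(x := p, y := q)"])
          show "inj_on (\<phi>(x := p, y := q)) (insert y K)"
            using other inj_on_subset[OF phi(2), of K] pq(3) xy(3) 2 by (auto simp: inj_on_def K_def)
        qed (use K xy U pq phi(3) in \<open>auto simp: K_def\<close>)
        then show ?thesis using card_J[OF 2(2)] K xy by blast
      next
        case 3
        have "\<phi> y \<in> {p, q}" using phi(3)[OF 3(2)] S(2,3) Spq by auto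
        moreover have "\<phi> y \<noteq> \<phi> e" using inj[OF 3(2) True] xy eF by auto
        moreover have "\<phi> z \<noteq> \<phi> y" "\<phi> z \<noteq> \<phi> e" if "z \<in> K" "z \<noteq> y" for z
          using inj[of z y] inj[of z e] 3(2) True that by (auto simp: K_def)
        ultimately have other: "\<phi> z \<notin> {p, q}" if "z \<in> K" "z \<noteq> y" for z
          using that pe by auto
        have "indep (insert x K)"
        proof (rule partial_transversalI[where \<phi>="\<phi>(x := p, y := q)"])
          show "inj_on (\<phi>(x := p, y := q)) (insert x K)"
            using other inj_on_subset[OF phi(2), of K] pq(3) xy(3) 3 by (auto simp: inj_on_def K_def)
        qed (use K xy U pq phi(3) in \<open>auto simp: K_def\<close>)
        then show ?thesis using card_J[OF 3(1)] K xy by blast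
      next
        case 4
        obtain z where z: "z \<in> {x, y}" "\<phi> e \<in> meeting \<C> {z}" using pe pq by blast
        have zI: "z \<notin> I" using z 4 by blast
        have other: "\<phi> w \<noteq> \<phi> e" if "w \<in> K" for w
          using inj[of w e] True that by (auto simp: K_def)
        have "indep (insert z K)"
        proof (rule partial_transversalI[where \<phi>="\<phi>(z := \<phi> e)"])
          show "inj_on (\<phi>(z := \<phi> e)) (insert z K)"
          proof -
            have "inj_on \<phi> K" using phi(2) by (rule inj_on_subset) (auto simp: K_def)
            moreover have "\<phi> e \<notin> \<phi> ` K" using other by force
            ultimately have "inj_on (\<phi>(z := \<phi> e)) K" by (rule inj_on_fun_updI)
            moreover have "(\<phi>(z := \<phi> e)) ` K = \<phi> ` K"
              using zI by (intro image_cong) (auto simp: K_def)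
            ultimately show ?thesis using \<open>\<phi> e \<notin> \<phi> ` K\<close> by auto
          qed
        qed (use K xy U z zI phi(3) in \<open>auto simp: K_def\<close>)
        then show ?thesis using card_J[OF zI] K xy z by blast
      qed
    qed
  qed
  then show False using eF by simp
qed

text \<open>Apply \<open>flatI\<close> with \<open>r = card X\<close>, taking the whole of
  \<open>insert e X\<close> as the larger independent set. For \<open>X = U\<close> the condition is
  vacuous, which gives \<open>flat_ground\<close>.\<close>

lemma flat_of_indep_insert:
  assumes "X \<subseteq> U" "\<And>e. e \<in> U - X \<Longrightarrow> indep (insert e X)"
  shows "X \<in> flats U indep"
proof (rule flatI[OF finite_ground assms(1), of _ "card X"])
  fix e assume "e \<in> U - X"
  then show "\<exists>I\<subseteq>insert e X. indep I \<and> card X < card I"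
    using assms finite_subset_ground[OF assms(1)] by (intro exI[of _ "insert e X"]) auto
qed (use finite_subset_ground[OF assms(1)] in \<open>auto simp: partial_transversal_empty card_mono\<close>)

lemma flat_empty: "{} \<in> flats U indep"
  by (rule flat_of_indep_insert) (auto intro: indep_singleton)

lemma flat_singleton: "u \<in> U \<Longrightarrow> {u} \<in> flats U indep"
  by (rule flat_of_indep_insert) (auto intro: indep_doubleton)

lemma flat_ground: "U \<in> flats U indep"
  by (rule flat_of_indep_insert) auto

text \<open>A transversal of the set injects into the two members at \<open>x\<close>, so its rank
  is at most 2. An outside point together with two points of the set is independent, since a
  dependent triple would lie in some \<open>E_set\<close>, which by \<open>only\<close> is the same
  set.\<close>

lemma flat_E_set:
  assumes x: "card (meeting \<C> {x}) = 2" and card: "2 \<le> card (E_set U \<C> x)"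
    and only: "\<And>z. z \<in> U \<Longrightarrow> card (meeting \<C> {z}) = 2 \<Longrightarrow> E_set U \<C> z = E_set U \<C> x"
  shows "E_set U \<C> x \<in> flats U indep"
proof (rule flatI[OF finite_ground, of _ _ 2])
  fix I assume I: "I \<subseteq> E_set U \<C> x" "indep I"
  then obtain \<phi> where phi: "inj_on \<phi> I" "\<And>e. e \<in> I \<Longrightarrow> \<phi> e \<in> meeting \<C> {e}"
    using partial_transversalE by metis
  have "\<phi> ` I \<subseteq> meeting \<C> {x}" using phi I(1) by (auto simp: E_set_def)
  moreover have "finite (meeting \<C> {x})" using x by (simp add: card_ge_0_finite)
  ultimately have "card (\<phi> ` I) \<le> 2" using x card_mono by metis
  then show "card I \<le> 2" using card_image[OF phi(1)] by simp
next
  fix e assume e: "e \<in> U - E_set U \<C> x"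
  obtain T where "T \<subseteq> E_set U \<C> x" "card T = 2" using card by (meson obtain_subset_with_card_n)
  then obtain y z where yz: "y \<in> E_set U \<C> x" "z \<in> E_set U \<C> x" "y \<noteq> z"
    by (auto simp: card_2_iff)
  have "indep {e, y, z}"
  proof (rule ccontr)
    assume "\<not> ?thesis"
    moreover have "e \<in> U" "y \<in> U" "z \<in> U" "e \<noteq> y" "e \<noteq> z" using e yz by (auto simp: E_set_def)
    ultimately obtain w where "w \<in> {e, y, z}" "card (meeting \<C> {w}) = 2" "{e, y, z} \<subseteq> E_set U \<C> w"
      using dependent_triple yz(3) by metis
    then show False using only[of w] e yz by (auto simp: E_set_def)
  qed
  then show "\<exists>I\<subseteq>insert e (E_set U \<C> x). indep I \<and> 2 < card I"
  proof (intro exI conjI)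
    have "e \<noteq> y" "e \<noteq> z" using yz e by auto
    then show "2 < card {e, y, z}" using yz(3) by simp
  qed (use yz in auto)
qed (auto simp: E_set_def partial_transversal_empty)

section \<open>Order and height in the lattice of flats\<close>

lemma carrier_L: "carrier L = flats U indep"
  by (simp add: covering_lattice_def)

lemma le_L: "X \<sqsubseteq>\<^bsub>L\<^esub> Y \<longleftrightarrow> X \<subseteq> Y"
  by (simp add: covering_lattice_def)

lemma lless_L: "X \<sqsubset>\<^bsub>L\<^esub> Y \<longleftrightarrow> X \<subset> Y"
  by (auto simp: covering_lattice_def lless_def)

text \<open>Members of a chain are separated by their cardinalities, which lie below
  \<open>card X\<close> for proper subsets of \<open>X\<close>; the given chain attains this
  bound.\<close>

lemma height_eq_card:
  assumes X: "X \<subseteq> U" and K: "is_chain L K" "\<And>Y. Y \<in> K \<Longrightarrow> Y \<subset> X" "card K = card X"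
  shows "height L X = card X"
proof -
  have finX: "finite X" using finite_subset_ground[OF X] .
  have le: "card K' \<le> card X" if K': "is_chain L K'" "\<forall>Y\<in>K'. Y \<sqsubset>\<^bsub>L\<^esub> X" for K'
  proof -
    have sub: "Y \<subset> X" if "Y \<in> K'" for Y using K'(2) that by (simp add: lless_L)
    have "inj_on card K'"
    proof (rule inj_onI)
      fix Y Z assume YZ: "Y \<in> K'" "Z \<in> K'" "card Y = card Z"
      have "finite Y" "finite Z" using sub[OF YZ(1)] sub[OF YZ(2)] finX finite_subset by blast+
      moreover have "Y \<subseteq> Z \<or> Z \<subseteq> Y" using K'(1) YZ by (auto simp: is_chain_def le_L)
      ultimately show "Y = Z" using YZ(3) by (metis card_subset_eq)
    qed
    moreover have "card ` K' \<subseteq> {..<card X}" using sub finX by (auto intro: psubset_card_mono)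
    ultimately have "card K' \<le> card {..<card X}" by (metis card_inj_on_le finite_lessThan)
    then show ?thesis by simp
  qed
  show ?thesis unfolding height_def
  proof (rule Max_eqI)
    show "finite {card K |K. is_chain L K \<and> (\<forall>Y\<in>K. Y \<sqsubset>\<^bsub>L\<^esub> X)}"
      by (rule finite_subset[of _ "{..card X}"]) (use le in auto)
    show "card X \<in> {card K |K. is_chain L K \<and> (\<forall>Y\<in>K. Y \<sqsubset>\<^bsub>L\<^esub> X)}"
      using K by (auto simp: lless_L intro!: exI[of _ K])
  qed (use le in auto)
qed

lemma height_singleton: "u \<in> U \<Longrightarrow> height L {u} = 1"
  by (subst height_eq_card[of _ "{{}}"]) (auto simp: is_chain_def carrier_L flat_empty le_L)

lemma height_doubleton:
  assumes "u \<in> U" "v \<in> U" "u \<noteq> v"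
  shows "height L {u, v} = 2"
  by (subst height_eq_card[of _ "{{}, {u}}"])
    (use assms in \<open>auto simp: is_chain_def carrier_L flat_empty flat_singleton le_L\<close>)

section \<open>Lines, and the effect of uniformity\<close>

lemma ex_dependent_triple:
  assumes "card (level L 2) < card U choose 2"
  obtains a b c where "a \<in> U" "b \<in> U" "c \<in> U" "a \<noteq> b" "a \<noteq> c" "b \<noteq> c" "\<not> indep {a, b, c}"
proof -
  have "\<exists>a\<in>U. \<exists>b\<in>U. \<exists>c\<in>U. a \<noteq> b \<and> a \<noteq> c \<and> b \<noteq> c \<and> \<not> indep {a, b, c}"
  proof (rule ccontr)
    assume no: "\<not> ?thesis"
    \<comment> \<open>If all triples are independent, every pair is a flat of height 2, and there
      are too many of them.\<close>
    have "{u, v} \<in> level L 2" if "u \<in> U" "v \<in> U" "u \<noteq> v" for u v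
    proof -
      have "{u, v} \<in> flats U indep"
        by (rule flat_of_indep_insert) (use that no in auto)
      then show ?thesis using height_doubleton[OF that] by (simp add: level_def carrier_L)
    qed
    then have sub: "{{u, v} |u v. u \<in> U \<and> v \<in> U \<and> u \<noteq> v} \<subseteq> level L 2" by blast
    have "finite (level L 2)"
      by (rule finite_subset[of _ "Pow U"]) (auto simp: level_def carrier_L flats_def finite_ground)
    then have "card U choose 2 \<le> card (level L 2)"
      using card_mono[OF _ sub] card_doubletons[OF finite_ground] by simp
    then show False using assms by simp
  qed
  then show ?thesis using that by blast
qed

lemma bounded_antichain_L:
  assumes unif: "uniform L" and lev: "card (level L 2) < card U choose 2"
    and E1: "card (E_family U \<C>) = 1"
  shows "bounded_antichain L {} U ((\<lambda>u. {u}) ` U)"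
proof -
  obtain a b c where abc: "a \<in> U" "b \<in> U" "c \<in> U" "a \<noteq> b" "a \<noteq> c" "b \<noteq> c" "\<not> indep {a, b, c}"
    using ex_dependent_triple[OF lev] .
  then obtain x where x: "x \<in> {a, b, c}" "card (meeting \<C> {x}) = 2" "{a, b, c} \<subseteq> E_set U \<C> x"
    using dependent_triple by metis
  define E where "E = E_set U \<C> x"
  have xU: "x \<in> U" using x abc by blast
  have EU: "E \<subseteq> U" and finE: "finite E" and xE: "x \<in> E"
    using xU finite_ground by (auto simp: E_def E_set_def)
  have card_E: "3 \<le> card E"
    using card_mono[OF finE, of "{a, b, c}"] x(3) abc by (simp add: E_def)
  \<comment> \<open>Here \<open>k = 1\<close> enters: the line \<open>E\<close> is the only possible
    \<open>E_set\<close>.\<close>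
  have only: "E_set U \<C> z = E" if "z \<in> U" "card (meeting \<C> {z}) = 2" for z
  proof -
    have "E_set U \<C> z \<in> E_family U \<C>" "E \<in> E_family U \<C>"
      using that xU x(2) unfolding E_family_def E_def by blast+
    then show ?thesis using E1 by (metis card_1_singletonE singletonD)
  qed
  have flat_E: "E \<in> flats U indep"
    unfolding E_def by (rule flat_E_set) (use x(2) card_E only in \<open>auto simp: E_def\<close>)
  have span: "E \<subseteq> F" if F: "F \<in> flats U indep" and yz: "y \<in> F" "z \<in> F" "y \<noteq> z" "y \<in> E" "z \<in> E" for F y z
  proof
    fix e assume "e \<in> E"
    then show "e \<in> F"
      using flat_memI_span[OF F yz(1-3) x(2), of e] yz by (auto simp: E_def E_set_def)
  qed
  \<comment> \<open>A further point in the closure would give a dependent triple, and such a triple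
    lies inside \<open>E\<close>, whereas \<open>p\<close> does not.\<close>
  have flat_pair: "{p, q} \<in> flats U indep" if p: "p \<in> U - E" "q \<in> U" for p q
  proof (cases "p = q")
    case True
    then show ?thesis using p flat_singleton by simp
  next
    case False
    show ?thesis
    proof (rule flat_of_indep_insert)
      fix r assume r: "r \<in> U - {p, q}"
      show "indep (insert r {p, q})"
      proof (rule ccontr)
        assume "\<not> ?thesis"
        then obtain w where "w \<in> {r, p, q}" "card (meeting \<C> {w}) = 2" "{r, p, q} \<subseteq> E_set U \<C> w"
          using dependent_triple[of r p q] p r False by auto
        then show False using only[of w] p r by auto
      qed
    qed (use p in auto)
  qed
  \<comment> \<open>Compare the lines through \<open>x\<close> in \<open>E\<close> with those
    through a point \<open>p\<close> outside: the former are bounded from above, the latter from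
    below, and uniformity at height 1 makes the two numbers equal.\<close>
  have "E = U"
  proof (rule ccontr)
    assume "E \<noteq> U"
    then obtain p where p: "p \<in> U - E" using EU by blast
    let ?cov = "\<lambda>X. {F \<in> carrier L. covered_by L X F}"
    have finC: "finite (?cov X)" for X
      by (rule finite_subset[of _ "Pow U"]) (auto simp: carrier_L flats_def finite_ground)
    have "(\<lambda>q. {p, q}) ` (U - {p}) \<subseteq> ?cov {p}"
    proof
      fix F assume "F \<in> (\<lambda>q. {p, q}) ` (U - {p})"
      then obtain q where q: "q \<in> U" "q \<noteq> p" "F = {p, q}" by blast
      then show "F \<in> ?cov {p}"
        using flat_pair[OF p q(1)] by (auto simp: carrier_L covered_by_def lless_L)
    qed
    moreover have "inj_on (\<lambda>q. {p, q}) (U - {p})" by (auto simp: inj_on_def doubleton_eq_iff)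
    ultimately have ge: "card U - 1 \<le> card (?cov {p})"
      using card_inj_on_le[OF _ _ finC, of _ "U - {p}" "{p}"] p by simp
    \<comment> \<open>A line through \<open>x\<close> with a second point in \<open>E\<close> is
      \<open>E\<close> itself; any other is a pair with a point outside \<open>E\<close>.\<close>
    have "?cov {x} \<subseteq> insert E ((\<lambda>y. {x, y}) ` (U - E))"
    proof
      fix F assume "F \<in> ?cov {x}"
      then have F: "F \<in> flats U indep" "{x} \<subset> F"
        and min: "\<And>H. H \<in> flats U indep \<Longrightarrow> {x} \<subset> H \<Longrightarrow> \<not> H \<subset> F"
        by (auto simp: carrier_L covered_by_def lless_L)
      then obtain y where y: "y \<in> F" "y \<noteq> x" by blast
      show "F \<in> insert E ((\<lambda>y. {x, y}) ` (U - E))"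
      proof (cases "y \<in> E")
        case True
        then have "E \<subseteq> F" using span[OF F(1) _ y(1), of x] F(2) y(2) xE by blast
        then have "F = E" using min[OF flat_E] True xE y(2) by blast
        then show ?thesis by simp
      next
        case False
        then have yU: "y \<in> U - E" using y flatsD[OF F(1)] by blast
        then have "F = {x, y}"
          using min[of "{x, y}"] flat_pair[OF yU xU] F(2) y by (auto simp: insert_commute)
        then show ?thesis using yU by blast
      qed
    qed
    moreover have "finite (U - E)" using finite_ground by simp
    ultimately have "card (?cov {x}) \<le> card (insert E ((\<lambda>y. {x, y}) ` (U - E)))"
      by (intro card_mono) auto
    also have "\<dots> \<le> Suc (card ((\<lambda>y. {x, y}) ` (U - E)))" by (rule card_insert_le_m1) auto
    also have "\<dots> \<le> Suc (card (U - E))" using finite_ground by (simp add: card_image_le)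
    also have "\<dots> = Suc (card U - card E)" using finE EU by (simp add: card_Diff_subset)
    finally have le: "card (?cov {x}) \<le> Suc (card U - card E)" .
    \<comment> \<open>This keeps the natural-number subtraction from truncating; with at least three
      points in \<open>E\<close>, one plus the number of points outside \<open>E\<close> is less
      than \<open>card U - 1\<close>.\<close>
    have "card E \<le> card U" using EU finite_ground by (rule card_mono[rotated])
    then have "card (?cov {x}) < card (?cov {p})" using ge le card_E by linarith
    moreover have "card (?cov {x}) = card (?cov {p})"
      using unif xU p height_singleton flat_singleton by (auto simp: uniform_def carrier_L)
    ultimately show False by simp
  qed
  \<comment> \<open>As \<open>E = U\<close>, a flat with two distinct points is the whole ground
    set.\<close>
  have flats: "flats U indep = insert {} (insert U ((\<lambda>u. {u}) ` U))"
  proof (intro subset_antisym subsetI)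
    fix F assume F: "F \<in> flats U indep"
    show "F \<in> insert {} (insert U ((\<lambda>u. {u}) ` U))"
    proof (cases "\<exists>y z. y \<in> F \<and> z \<in> F \<and> y \<noteq> z")
      case True
      then show ?thesis using span[OF F] flatsD[OF F] \<open>E = U\<close> by blast
    next
      case False
      then show ?thesis using flatsD[OF F] by blast
    qed
  qed (use flat_empty flat_singleton flat_ground in auto)
  have "U \<noteq> {u}" for u using abc by blast
  then show ?thesis
    unfolding bounded_antichain_def carrier_L flats le_L using xU by auto
qed

end

section \<open>Coverings for n = 0 and n = 1, and the final comparison\<close>

lemma flats_singleton_covering: "flats {u} (partial_transversal {u} {{u}}) = {{}, {u}}"
proof -
  interpret simple_covering "{u}" "{{u}}"
    by unfold_locales (auto simp: covering_def)
  show ?thesis using flat_empty flat_ground flatsD by blast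
qed

lemma flats_empty_covering: "flats {} (partial_transversal {} {}) = {{}}"
proof -
  interpret simple_covering "{}" "{}"
    by unfold_locales (auto simp: covering_def)
  show ?thesis using flat_empty flatsD by blast
qed

theorem theorem4p16:
  fixes G :: "('g, 'b) monoid_scheme" and n :: nat
  assumes "group G" and "finite (carrier G)"
  shows "(n = 0 \<or> n = 1 \<longrightarrow>
           (\<exists>(U :: nat set) \<C>. finite U \<and> covering U \<C> \<and>
              order_isomorphic (covering_lattice U \<C>) (dowling_lattice n G)))
       \<and> (\<forall>(U :: 'a set) \<C> m k.
            finite U \<and> covering U \<C> \<and> card U = m \<and>
            \<not> (\<exists>u\<in>U. \<exists>v\<in>U. u \<noteq> v \<and> meeting \<C> {u} = meeting \<C> {v} \<and> card (meeting \<C> {u}) = 1) \<and>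
            uniform (covering_lattice U \<C>) \<and>
            card (level (covering_lattice U \<C>) 2) < m choose 2 \<and>
            k = card (E_family U \<C>) \<longrightarrow>
            n = 2 \<and> m = order G + 2 \<and> k = 1 \<longrightarrow>
            order_isomorphic (covering_lattice U \<C>) (dowling_lattice n G))"
proof (intro conjI impI allI)
  assume "n = 0 \<or> n = 1"
  then show "\<exists>(U :: nat set) \<C>. finite U \<and> covering U \<C> \<and>
      order_isomorphic (covering_lattice U \<C>) (dowling_lattice n G)"
  proof
    assume n: "n = 0"
    obtain p where p: "carrier (dowling_lattice 0 G) = {p}" "p \<sqsubseteq>\<^bsub>dowling_lattice 0 G\<^esub> p"
      using dowling_lattice_0[OF assms(1)] .
    have "order_isomorphic (covering_lattice ({} :: nat set) {}) (dowling_lattice n G)"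
      unfolding order_isomorphic_def n p(1)
      using p(2) by (intro exI[of _ "\<lambda>_. p"]) (simp add: covering_lattice_def flats_empty_covering bij_betw_def)
    then show ?thesis by (intro exI[of _ "{}"]) (simp add: covering_def)
  next
    assume n: "n = 1"
    obtain b t where bt: "bounded_antichain (dowling_lattice 1 G) b t {}"
      using dowling_lattice_1[OF assms(1)] .
    have "bounded_antichain (covering_lattice {0 :: nat} {{0}}) {} {0} {}"
      by (auto simp: bounded_antichain_def covering_lattice_def flats_singleton_covering)
    then have "order_isomorphic (covering_lattice {0 :: nat} {{0}}) (dowling_lattice n G)"
      unfolding n using bt by (rule bounded_antichain_isomorphic) simp_all
    then show ?thesis by (intro exI[of _ "{0}"] exI[of _ "{{0}}"]) (simp add: covering_def)
  qed
next
  fix U :: "'a set" and \<C> m k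
  assume *: "finite U \<and> covering U \<C> \<and> card U = m \<and>
      \<not> (\<exists>u\<in>U. \<exists>v\<in>U. u \<noteq> v \<and> meeting \<C> {u} = meeting \<C> {v} \<and> card (meeting \<C> {u}) = 1) \<and>
      uniform (covering_lattice U \<C>) \<and>
      card (level (covering_lattice U \<C>) 2) < m choose 2 \<and> k = card (E_family U \<C>)"
    and **: "n = 2 \<and> m = order G + 2 \<and> k = 1"
  interpret simple_covering U \<C>
    using * by unfold_locales blast+
  have ba: "bounded_antichain L {} U ((\<lambda>u. {u}) ` U)"
    using * ** by (intro bounded_antichain_L) auto
  obtain b t A where A: "bounded_antichain (dowling_lattice 2 G) b t A" "finite A"
    "card A = order G + 2"
    using dowling_lattice_2[OF assms] .
  \<comment> \<open>Both lattices are bounded antichains; this matches their middle parts, both of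
    size \<open>order G + 2\<close>.\<close>
  have "card ((\<lambda>u. {u}) ` U) = card A" using * ** A(3) by (simp add: card_image)
  then show "order_isomorphic L (dowling_lattice n G)"
    using bounded_antichain_isomorphic[OF ba A(1)] A(2) * ** by simp
qed

end
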